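(* Let $K>2$ be an integer and consider the $K$-armed binary utility-based dueling bandit game, viewed as a finite partial monitoring game with action set $\boldsymbol{N}=\{(i,j): 1\le i\le j\le K\}$, outcome set $\boldsymbol{M}=\{0,1\}^K$, gain function $\mathcal{G}((i,j),\boldsymbol{m})=\frac{\boldsymbol{m}_i+\boldsymbol{m}_j}{2}$, and feedback function $\mathcal{H}((i,j),\boldsymbol{m})$ equal to "loss" if $\boldsymbol{m}_i<\boldsymbol{m}_j$, "tie" if $\boldsymbol{m}_i=\boldsymbol{m}_j$, and "win" if $\boldsymbol{m}_i>\boldsymbol{m}_j$. Then this game is easy, and its regret satisfies $R_T\in\tilde{\Theta}(\sqrt{T})$ as $T\to\infty$ (with $K$ fixed).
   Context: The game. In each round $t=1,\dots,T$ the opponent chooses an outcome $J_t\in\boldsymbol{M}$ and simultaneously the (possibly randomized) learner chooses an action $I_t\in\boldsymbol{N}$. The learner earns $\mathcal{G}(I_t,J_t)$ and observes only the symbol $\mathcal{H}(I_t,J_t)$; the outcome and the gain remain hidden. The functions $\mathcal{G}$ and $\mathcal{H}$ are known to the learner. The choice $I_t$ may depend only on the learner's past actions, past feedback symbols and internal randomness. Regret. The regret of the game is the minimax expected cumulative regret against the best fixed action, $$R_T=\inf_{\text{learner}}\ \sup_{J_1,\dots,J_T\in\boldsymbol{M}}\ \max_{a\in\boldsymbol{N}}\ \mathbb{E}\left[\sum_{t=1}^T\big(\mathcal{G}(a,J_t)-\mathcal{G}(I_t,J_t)\big)\right],$$ where the infimum is over learner strategies. The notation $R_T\in\tilde{\Theta}(\sqrt{T})$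 means that $R_T$ is of order $\sqrt{T}$ from above and below up to factors polylogarithmic in $T$, with constants that may depend on the game (hence on $K$). Gain vectors and cells. For $a\in\boldsymbol{N}$ let $\boldsymbol{g}_a=(\mathcal{G}(a,\boldsymbol{m}))_{\boldsymbol{m}\in\boldsymbol{M}}\in\mathbb{R}^{\boldsymbol{M}}$. Let $\Delta_{|\boldsymbol{M}|}=\{\boldsymbol{q}\in[0,1]^{\boldsymbol{M}} : \sum_{\boldsymbol{m}}\boldsymbol{q}_{\boldsymbol{m}}=1\}$. The cell of $a$ is $C_a=\{\boldsymbol{q}\in\Delta_{|\boldsymbol{M}|} : \boldsymbol{g}_a^{\top}\boldsymbol{q}=\max_{b\in\boldsymbol{N}}\boldsymbol{g}_b^{\top}\boldsymbol{q}\}$. An action is strongly Pareto-optimal if its cell has positive $(|\boldsymbol{M}|-1)$-dimensional volume. Two strongly Pareto-optimal actions $a,b$ are neighbors if $C_a\cap C_b$ is an $(|\boldsymbol{M}|-2)$-dimensional polytope. Signal matrices and local observability. For an action $a$, let $\sigma_1,\dots,\sigma_{s_a}$ be the distinct symbols occurring among $\mathcal{H}(a,\boldsymbol{m})$, $\boldsymbol{m}\in\boldsymbol{M}$. The signal matrix $\mathcal{S}_a$ is the $s_a\times|\boldsymbol{M}|$ matrix with $\mathcal{S}_a(k,\boldsymbol{m})=1$ if $\mathcal{H}(a,\boldsymbol{m})=\sigma_k$ and $0$ otherwise. For neighboring actions $a,b$, the local signal matrix $\mathcal{S}_{a,b}$ is obtained by stacking vertically the matrices $\mathcal{S}_c$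 for all $c\in\boldsymbol{N}$ with $C_a\cap C_b\subseteq C_c$. The difference $\boldsymbol{g}_a-\boldsymbol{g}_b$ is locally observable if $\boldsymbol{g}_a-\boldsymbol{g}_b\in\operatorname{Im}\mathcal{S}_{a,b}^{\top}$. Easy games. A game is trivial if some action $a$ has $C_a=\Delta_{|\boldsymbol{M}|}$. A game is easy if it is not trivial and, for every pair of neighboring (strongly Pareto-optimal) actions $a,b$, the difference $\boldsymbol{g}_a-\boldsymbol{g}_b$ is locally observable. *)

theory Defs
  imports
    "HOL-Analysis.Analysis"
    "HOL-Probability.Probability"
    "HOL-Library.Landau_Symbols"
begin

(* The outcome set of a game is the whole type 'm, which is required to be finite, so that
   the vectors indexed by outcomes are the elements of real ^ 'm. *)
record ('a, 'm, 's) pm_game =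
  actions :: "'a set"
  gain :: "'a \<Rightarrow> 'm \<Rightarrow> real"
  feedback :: "'a \<Rightarrow> 'm \<Rightarrow> 's"

(* A randomized learner maps the past actions and feedback symbols (oldest first) to the
   distribution of the next action. *)
type_synonym ('a, 's) learner = "('a \<times> 's) list \<Rightarrow> 'a pmf"

definition learners :: "('a, 'm, 's) pm_game \<Rightarrow> ('a, 's) learner set" where
  "learners G = {L. \<forall>h. set_pmf (L h) \<subseteq> actions G}"

(* Rounds are numbered from 0, so the outcomes of the first T rounds are J 0, ..., J (T - 1). *)
primrec history ::
  "('a, 'm, 's) pm_game \<Rightarrow> ('a, 's) learner \<Rightarrow> (nat \<Rightarrow> 'm) \<Rightarrow> nat \<Rightarrow> ('a \<times> 's) list pmf"
where
  "history G L J 0 = return_pmf []"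
| "history G L J (Suc t) =
     bind_pmf (history G L J t)
       (\<lambda>h. map_pmf (\<lambda>I. h @ [(I, feedback G I (J t))]) (L h))"

definition expected_regret ::
  "('a, 'm, 's) pm_game \<Rightarrow> ('a, 's) learner \<Rightarrow> nat \<Rightarrow> (nat \<Rightarrow> 'm) \<Rightarrow> 'a \<Rightarrow> real"
where
  "expected_regret G L T J a =
     measure_pmf.expectation (history G L J T)
       (\<lambda>h. \<Sum>t<T. gain G a (J t) - gain G (fst (h ! t)) (J t))"

(* For finite actions and outcomes all values lie in [-c * T, c * T] for some c, so the real
   INF and SUP are proper; the values of J from T on play no role. *)
definition regret :: "('a, 'm::finite, 's) pm_game \<Rightarrow> nat \<Rightarrow> real" where
  "regret G T =
     (INF L\<in>learners G. SUP J. Max ((\<lambda>a. expected_regret G L T J a) ` actions G))"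

(* Equality of order up to polylogarithmic factors. *)
definition soft_Theta :: "(nat \<Rightarrow> real) \<Rightarrow> (nat \<Rightarrow> real) set" where
  "soft_Theta f =
     {g. \<exists>k::nat. g \<in> O(\<lambda>T. f T * ln (real T) ^ k) \<and> g \<in> \<Omega>(\<lambda>T. f T / ln (real T) ^ k)}"

definition gain_vec :: "('a, 'm::finite, 's) pm_game \<Rightarrow> 'a \<Rightarrow> real ^ 'm" where
  "gain_vec G a = (\<chi> m. gain G a m)"

definition prob_simplex :: "(real ^ 'm::finite) set" where
  "prob_simplex = {q. (\<forall>m. 0 \<le> q $ m \<and> q $ m \<le> 1) \<and> (\<Sum>m\<in>UNIV. q $ m) = 1}"

definition cell :: "('a, 'm::finite, 's) pm_game \<Rightarrow> 'a \<Rightarrow> (real ^ 'm) set" where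
  "cell G a =
     {q \<in> prob_simplex. gain_vec G a \<bullet> q = Max ((\<lambda>b. gain_vec G b \<bullet> q) ` actions G)}"

(* The volume, of dimension CARD('m) - 1, of a subset C of the hyperplane of vectors with
   coordinate sum 1: the Lebesgue measure of the right prism over C with height 1. The
   vector u is the unit normal of the hyperplane. *)
definition simplex_volume :: "(real ^ 'm::finite) set \<Rightarrow> ennreal" where
  "simplex_volume C =
     (let u = vec (1 / sqrt (real CARD('m)))
      in emeasure lebesgue {q + t *\<^sub>R u | q t. q \<in> C \<and> 0 \<le> t \<and> t \<le> 1})"

definition strongly_pareto_optimal :: "('a, 'm::finite, 's) pm_game \<Rightarrow> 'a \<Rightarrow> bool" where
  "strongly_pareto_optimal G a \<longleftrightarrow> a \<in> actions G \<and> simplex_volume (cell G a) > 0"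

definition neighbors :: "('a, 'm::finite, 's) pm_game \<Rightarrow> 'a \<Rightarrow> 'a \<Rightarrow> bool" where
  "neighbors G a b \<longleftrightarrow>
     strongly_pareto_optimal G a \<and> strongly_pareto_optimal G b \<and>
     polytope (cell G a \<inter> cell G b) \<and>
     aff_dim (cell G a \<inter> cell G b) = int CARD('m) - 2"

(* Numbers of rows vary from action to action, so a matrix is given by a finite set of row
   indices together with the function that maps every index to its row. The rows of the
   signal matrix of an action are indexed by the symbols themselves. *)
definition symbols :: "('a, 'm, 's) pm_game \<Rightarrow> 'a \<Rightarrow> 's set" where
  "symbols G a = range (feedback G a)"

definition signal_matrix :: "('a, 'm::finite, 's) pm_game \<Rightarrow> 'a \<Rightarrow> 's \<Rightarrow> real ^ 'm" where
  "signal_matrix G a s = (\<chi> m. if feedback G a m = s then 1 else 0)"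

(* Vertical stacking: row (c, s) is row s of the signal matrix of c. *)
definition local_rows :: "('a, 'm::finite, 's) pm_game \<Rightarrow> 'a \<Rightarrow> 'a \<Rightarrow> ('a \<times> 's) set" where
  "local_rows G a b =
     (SIGMA c : {c \<in> actions G. cell G a \<inter> cell G b \<subseteq> cell G c}. symbols G c)"

definition local_signal_matrix :: "('a, 'm::finite, 's) pm_game \<Rightarrow> 'a \<times> 's \<Rightarrow> real ^ 'm" where
  "local_signal_matrix G = (\<lambda>(c, s). signal_matrix G c s)"

(* The image of the transpose of the matrix S with row indices R. *)
definition image_transpose :: "'r set \<Rightarrow> ('r \<Rightarrow> real ^ 'm::finite) \<Rightarrow> (real ^ 'm) set" where
  "image_transpose R S = range (\<lambda>y. \<Sum>r\<in>R. y r *\<^sub>R S r)"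

definition locally_observable :: "('a, 'm::finite, 's) pm_game \<Rightarrow> 'a \<Rightarrow> 'a \<Rightarrow> bool" where
  "locally_observable G a b \<longleftrightarrow>
     gain_vec G a - gain_vec G b \<in> image_transpose (local_rows G a b) (local_signal_matrix G)"

definition trivial_game :: "('a, 'm::finite, 's) pm_game \<Rightarrow> bool" where
  "trivial_game G \<longleftrightarrow> (\<exists>a\<in>actions G. cell G a = prob_simplex)"

definition easy_game :: "('a, 'm::finite, 's) pm_game \<Rightarrow> bool" where
  "easy_game G \<longleftrightarrow>
     \<not> trivial_game G \<and> (\<forall>a b. neighbors G a b \<longrightarrow> locally_observable G a b)"

datatype duel_result = Loss | Tie | Win

(* The arms are the elements of the finite linear order 'k, with CARD('k) in the role of the
   number of arms. An outcome is the vector of binary utilities of the arms, False standing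
   for 0 and True for 1; accordingly False < True. *)
definition dueling_game :: "('k::{finite, linorder} \<times> 'k, 'k \<Rightarrow> bool, duel_result) pm_game" where
  "dueling_game =
     \<lparr>actions = {(i, j). i \<le> j},
      gain = (\<lambda>(i, j) m. (of_bool (m i) + of_bool (m j)) / 2),
      feedback = (\<lambda>(i, j) m. if m i < m j then Loss else if m i = m j then Tie else Win)\<rparr>"

end

(* The cell of (i, j) consists of the distributions under which both arms have the maximal
   probability of being useful, so only the actions (i, i) have cells of full dimension. On the
   common boundary of the cells of (i, i) and (j, j) the action comparing i and j is optimal too,
   and its rows for Win and Loss differ by the difference of the two gain vectors.

   For the upper bound, draw both arms independently from an exponential-weights distribution p.
   The estimate (1[k = a] / p a - 1[k = b] / p b) (m a - m b) / 2 depends only on the observed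
   comparison of the arms a and b, has mean m k - (mean of m under p), which is the instantaneous
   regret against k, and has second moment at most 1 / (2 p k); the standard analysis of
   exponential weights then gives O(sqrt T).

   For the lower bound, no learner can gain more than 1/2 per round on average against an opponent
   that makes one of two fixed arms useful by a fair coin flip, whereas the better of the two arms
   exceeds T/2 by the order of sqrt T. *)

theory Submission
  imports Defs
begin

section \<open>Expected regret and minimax regret\<close>

lemma finite_set_pmf_history:
  assumes "finite (actions G)" "L \<in> learners G"
  shows "finite (set_pmf (history G L J t))"
proof (induction t)
  case (Suc t)
  have "finite (set_pmf (L h))" for h
    using assms finite_subset unfolding learners_def by blast
  with Suc show ?case by simp
qed simp

lemma length_history: "h \<in> set_pmf (history G L J t) \<Longrightarrow> length h = t"
  by (induction t arbitrary: h) auto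

lemma history_cong:
  "(\<And>s. s < t \<Longrightarrow> J s = J' s) \<Longrightarrow> history G L J t = history G L J' t"
  by (induction t) auto

lemma expectation_history_Suc:
  fixes f :: "('a \<times> 's) list \<Rightarrow> real"
  assumes "finite (actions G)" "L \<in> learners G"
  shows "measure_pmf.expectation (history G L J (Suc t)) f =
    measure_pmf.expectation (history G L J t)
      (\<lambda>h. measure_pmf.expectation (L h) (\<lambda>I. f (h @ [(I, feedback G I (J t))])))"
proof -
  have fin: "finite (set_pmf (L h))" for h
    using assms finite_subset unfolding learners_def by blast
  have H: "finite (set_pmf (history G L J t))"
    by (rule finite_set_pmf_history[OF assms])
  show ?thesis
    by (simp add: pmf_expectation_bind[OF H] fin integral_measure_pmf_real[OF H] mult.commute)
qed

lemma integrable_history: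
  fixes f :: "('a \<times> 's) list \<Rightarrow> real"
  assumes "finite (actions G)" "L \<in> learners G"
  shows "integrable (measure_pmf (history G L J t)) f"
  by (rule integrable_measure_pmf_finite[OF finite_set_pmf_history[OF assms]])

text \<open>The outcome \<open>m\<close> is kept apart from \<open>J\<close>, so that two candidate
  outcomes of round \<open>t\<close> can be weighed after the same history.\<close>

definition mean_gain ::
  "('a, 'm, 's) pm_game \<Rightarrow> ('a, 's) learner \<Rightarrow> (nat \<Rightarrow> 'm) \<Rightarrow> nat \<Rightarrow> 'm \<Rightarrow> real" where
  "mean_gain G L J t m =
     measure_pmf.expectation (history G L J t)
       (\<lambda>h. measure_pmf.expectation (L h) (\<lambda>I. gain G I m))"

text \<open>Turns the regret into a recursion over rounds, which carries the inductions below in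
  place of sums over histories.\<close>

lemma expected_regret_Suc:
  assumes "finite (actions G)" "L \<in> learners G"
  shows "expected_regret G L (Suc t) J a =
    expected_regret G L t J a + gain G a (J t) - mean_gain G L J t (J t)"
proof -
  let ?f = "\<lambda>n h. \<Sum>s<n. gain G a (J s) - gain G (fst (h ! s)) (J s)"
  let ?E = "\<lambda>h. measure_pmf.expectation (L h) (\<lambda>I. gain G I (J t))"
  have fin: "finite (set_pmf (L h))" for h
    using assms finite_subset unfolding learners_def by blast
  note int = integrable_measure_pmf_finite[OF fin]
  have "expected_regret G L (Suc t) J a = measure_pmf.expectation (history G L J t)
      (\<lambda>h. measure_pmf.expectation (L h) (\<lambda>I. ?f (Suc t) (h @ [(I, feedback G I (J t))])))"
    unfolding expected_regret_def by (rule expectation_history_Suc[OF assms])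
  also have "\<dots> = measure_pmf.expectation (history G L J t)
      (\<lambda>h. ?f t h + gain G a (J t) - ?E h)"
  \<comment> \<open>The integrands agree only on the support: there \<open>h\<close> has length
    \<open>t\<close>, so the appended pair sits at index \<open>t\<close>.\<close>
  proof (rule Bochner_Integration.integral_cong_AE)
    show "AE h in measure_pmf (history G L J t).
        measure_pmf.expectation (L h) (\<lambda>I. ?f (Suc t) (h @ [(I, feedback G I (J t))])) =
        ?f t h + gain G a (J t) - ?E h"
    proof (rule AE_pmfI)
      fix h assume h: "h \<in> set_pmf (history G L J t)"
      have "?f (Suc t) (h @ [(I, feedback G I (J t))]) =
          (?f t h + gain G a (J t)) - gain G I (J t)" for I
        using length_history[OF h] by (simp add: nth_append)
      then show "measure_pmf.expectation (L h) (\<lambda>I. ?f (Suc t) (h @ [(I, feedback G I (J t))])) =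
        ?f t h + gain G a (J t) - ?E h"
        by (simp only: Bochner_Integration.integral_diff[OF int int]) simp
    qed
  qed auto
  also have "\<dots> = expected_regret G L t J a + gain G a (J t) - mean_gain G L J t (J t)"
    unfolding expected_regret_def mean_gain_def by (simp add: integrable_history[OF assms])
  finally show ?thesis .
qed

lemma expected_regret_0 [simp]: "expected_regret G L 0 J a = 0"
  by (simp add: expected_regret_def)

text \<open>The first \<open>t\<close> rounds consult only outcomes before \<open>t\<close>, so the
  opponent may settle outcome \<open>t\<close> after inspecting the regret so far.\<close>

lemma expected_regret_cong:
  "(\<And>s. s < t \<Longrightarrow> J s = J' s) \<Longrightarrow> expected_regret G L t J a = expected_regret G L t J' a"
  unfolding expected_regret_def
  by (subst history_cong[of t J J']) (auto intro!: Bochner_Integration.integral_cong)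

lemma mean_gain_cong:
  "(\<And>s. s < t \<Longrightarrow> J s = J' s) \<Longrightarrow> mean_gain G L J t m = mean_gain G L J' t m"
  unfolding mean_gain_def by (subst history_cong[of t J J']) auto

lemma mean_gain_bounds:
  assumes "finite (actions G)" "L \<in> learners G"
    and "\<And>a. a \<in> actions G \<Longrightarrow> l \<le> gain G a m" "\<And>a. a \<in> actions G \<Longrightarrow> gain G a m \<le> u"
  shows "l \<le> mean_gain G L J t m" "mean_gain G L J t m \<le> u"
proof -
  have sub: "set_pmf (L h) \<subseteq> actions G" for h
    using assms unfolding learners_def by blast
  then have fin: "finite (set_pmf (L h))" for h
    using assms(1) finite_subset by blast
  note int = integrable_measure_pmf_finite[OF fin]
  have "l \<le> measure_pmf.expectation (L h) (\<lambda>I. gain G I m)" for h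
    using sub assms(3) by (intro measure_pmf.integral_ge_const int AE_pmfI) auto
  then show "l \<le> mean_gain G L J t m"
    unfolding mean_gain_def
    by (intro measure_pmf.integral_ge_const integrable_history[OF assms(1,2)]) auto
  have "measure_pmf.expectation (L h) (\<lambda>I. gain G I m) \<le> u" for h
    using sub assms(4) by (intro measure_pmf.integral_le_const int AE_pmfI) auto
  then show "mean_gain G L J t m \<le> u"
    unfolding mean_gain_def
    by (intro measure_pmf.integral_le_const integrable_history[OF assms(1,2)]) auto
qed

text \<open>The action is drawn without knowledge of the outcome, so \<open>m\<close> and
  \<open>m'\<close> meet the same distribution and a bound per action passes to the means.\<close>

lemma mean_gain_add:
  assumes "finite (actions G)" "L \<in> learners G"
    and "\<And>a. a \<in> actions G \<Longrightarrow> gain G a m + gain G a m' \<le> u"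
  shows "mean_gain G L J t m + mean_gain G L J t m' \<le> u"
proof -
  have sub: "set_pmf (L h) \<subseteq> actions G" for h
    using assms unfolding learners_def by blast
  then have fin: "finite (set_pmf (L h))" for h
    using assms(1) finite_subset by blast
  note int = integrable_measure_pmf_finite[OF fin]
  have "measure_pmf.expectation (L h) (\<lambda>I. gain G I m) +
      measure_pmf.expectation (L h) (\<lambda>I. gain G I m') \<le> u" for h
    unfolding Bochner_Integration.integral_add[OF int int, symmetric]
    using sub assms(3) by (intro measure_pmf.integral_le_const int AE_pmfI) auto
  then show ?thesis
    unfolding mean_gain_def
      Bochner_Integration.integral_add[OF integrable_history[OF assms(1,2)]
        integrable_history[OF assms(1,2)], symmetric]
    by (intro measure_pmf.integral_le_const integrable_history[OF assms(1,2)]) auto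
qed

lemma abs_expected_regret_le:
  assumes "finite (actions G)" "L \<in> learners G" "a \<in> actions G"
    and "\<And>a m. a \<in> actions G \<Longrightarrow> 0 \<le> gain G a m \<and> gain G a m \<le> 1"
  shows "\<bar>expected_regret G L t J a\<bar> \<le> real t"
proof (induction t)
  case (Suc t)
  have "0 \<le> mean_gain G L J t (J t)" "mean_gain G L J t (J t) \<le> 1"
    using assms by (auto intro!: mean_gain_bounds[OF assms(1,2)])
  then show ?case
    using Suc assms(4)[OF assms(3), of "J t"] unfolding expected_regret_Suc[OF assms(1,2)]
    by (simp add: abs_le_iff)
qed simp

lemma abs_Max_expected_regret_le:
  assumes "finite (actions G)" "actions G \<noteq> {}" "L \<in> learners G"
    and "\<And>a m. a \<in> actions G \<Longrightarrow> 0 \<le> gain G a m \<and> gain G a m \<le> 1"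
  shows "\<bar>Max ((\<lambda>a. expected_regret G L t J a) ` actions G)\<bar> \<le> real t"
proof -
  have "Max ((\<lambda>a. expected_regret G L t J a) ` actions G)
      \<in> (\<lambda>a. expected_regret G L t J a) ` actions G"
    using assms(1,2) by (intro Max_in) auto
  then show ?thesis
    using abs_expected_regret_le[OF assms(1,3) _ assms(4)] by auto
qed

text \<open>\<open>INF\<close> and \<open>SUP\<close> over the reals are reliable only on bounded
  sets; gains in [0, 1] confine every value to [-T, T].\<close>

lemma regret_le:
  assumes "finite (actions G)" "actions G \<noteq> {}" "L \<in> learners G"
    and "\<And>a m. a \<in> actions G \<Longrightarrow> 0 \<le> gain G a m \<and> gain G a m \<le> 1"
    and "\<And>J a. a \<in> actions G \<Longrightarrow> expected_regret G L T J a \<le> B"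
  shows "regret G T \<le> B"
proof -
  let ?M = "\<lambda>L J. Max ((\<lambda>a. expected_regret G L T J a) ` actions G)"
  have "- real T \<le> (SUP J. ?M L J)" if L: "L \<in> learners G" for L
  proof -
    have "bdd_above (range (?M L))"
      using abs_Max_expected_regret_le[OF assms(1,2) L assms(4)]
      by (intro bdd_aboveI[of _ "real T"]) (auto simp: abs_le_iff)
    moreover have "- real T \<le> ?M L J" for J
      using abs_Max_expected_regret_le[OF assms(1,2) L assms(4), of T J] by linarith
    ultimately show ?thesis
      by (meson UNIV_I cSUP_upper order_trans)
  qed
  then have "bdd_below ((\<lambda>L. SUP J. ?M L J) ` learners G)"
    by (intro bdd_belowI[of _ "- real T"]) auto
  then have "regret G T \<le> (SUP J. ?M L J)"
    unfolding regret_def by (rule cINF_lower) (rule assms(3))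
  also have "\<dots> \<le> B"
    using assms by (intro cSUP_least) auto
  finally show ?thesis .
qed

lemma regret_ge:
  assumes "finite (actions G)" "actions G \<noteq> {}"
    and "\<And>a m. a \<in> actions G \<Longrightarrow> 0 \<le> gain G a m \<and> gain G a m \<le> 1"
    and "\<And>L. L \<in> learners G \<Longrightarrow> \<exists>J. \<exists>a\<in>actions G. B \<le> expected_regret G L T J a"
  shows "B \<le> regret G T"
proof -
  let ?M = "\<lambda>L J. Max ((\<lambda>a. expected_regret G L T J a) ` actions G)"
  \<comment> \<open>Playing one action forever is a learner, so the infimum ranges over a nonempty
    set.\<close>
  obtain a where a: "a \<in> actions G" using assms(2) by blast
  have "(\<lambda>_. return_pmf a) \<in> learners G" using a by (simp add: learners_def)
  then have ne: "learners G \<noteq> {}" by blast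
  have "B \<le> (SUP J. ?M L J)" if L: "L \<in> learners G" for L
  proof -
    obtain J where J: "\<exists>a\<in>actions G. B \<le> expected_regret G L T J a"
      using assms(4)[OF L] by blast
    have "bdd_above (range (?M L))"
      using abs_Max_expected_regret_le[OF assms(1,2) L assms(3)]
      by (intro bdd_aboveI[of _ "real T"]) (auto simp: abs_le_iff)
    then have "?M L J \<le> (SUP J. ?M L J)" by (rule cSUP_upper2) auto
    moreover have "B \<le> ?M L J"
      using J assms(1) by (auto intro: order.trans[OF _ Max_ge])
    ultimately show ?thesis by linarith
  qed
  then show ?thesis
    unfolding regret_def by (intro cINF_greatest ne) auto
qed

section \<open>Actions and gains of the dueling game\<close>

lemma finite_actions_dueling [simp]:
  "finite (actions (dueling_game :: ('k::{finite, linorder} \<times> 'k, _, _) pm_game))"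
  by simp

lemma actions_dueling: "actions dueling_game = {(i, j). i \<le> j}"
  by (simp add: dueling_game_def)

lemma actions_dueling_nonempty [simp]: "actions dueling_game \<noteq> {}"
  by (auto simp: dueling_game_def)

lemma gain_dueling: "gain dueling_game (i, j) m = (of_bool (m i) + of_bool (m j)) / 2"
  by (simp add: dueling_game_def)

lemma gain_dueling_bounds: "0 \<le> gain dueling_game a m \<and> gain dueling_game a m \<le> 1"
  by (cases a) (simp add: gain_dueling)

section \<open>Cells and local observability\<close>

definition arm_prob :: "real ^ ('k::finite \<Rightarrow> bool) \<Rightarrow> 'k \<Rightarrow> real" where
  "arm_prob q i = (\<Sum>m\<in>UNIV. of_bool (m i) * q $ m)"

lemma gain_vec_dueling_inner:
  fixes q :: "real ^ ('k::{finite, linorder} \<Rightarrow> bool)"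
  shows "gain_vec dueling_game (i, j) \<bullet> q = (arm_prob q i + arm_prob q j) / 2"
  unfolding gain_vec_def inner_vec_def inner_real_def vec_lambda_beta gain_dueling arm_prob_def
    sum.distrib[symmetric] sum_divide_distrib
  by (rule sum.cong) (simp_all add: field_simps)

text \<open>Comparison with the diagonal actions \<open>(k, k)\<close> gives
  \<open>2 * p_k <= p_i + p_j\<close> for the marginals; taking \<open>k = i\<close> and
  \<open>k = j\<close> forces \<open>p_i = p_j\<close>.\<close>

lemma cell_dueling:
  fixes i j :: "'k::{finite, linorder}"
  assumes "i \<le> j"
  shows "cell dueling_game (i, j) =
    {q \<in> prob_simplex. \<forall>k. arm_prob q k \<le> arm_prob q i \<and> arm_prob q k \<le> arm_prob q j}"
    (is "_ = {q \<in> _. ?opt q}")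
proof -
  have "gain_vec dueling_game (i, j) \<bullet> q =
      Max ((\<lambda>b. gain_vec dueling_game b \<bullet> q) ` actions dueling_game) \<longleftrightarrow> ?opt q" (is "?eq = _") for q
  proof -
    let ?A = "(\<lambda>b. gain_vec dueling_game b \<bullet> q) ` actions dueling_game"
    have "finite ?A" "?A \<noteq> {}" "gain_vec dueling_game (i, j) \<bullet> q \<in> ?A"
      using assms by (auto simp: actions_dueling)
    then have "?eq \<longleftrightarrow> (\<forall>x\<in>?A. x \<le> gain_vec dueling_game (i, j) \<bullet> q)"
      by (metis Max_eq_iff)
    also have "\<dots> \<longleftrightarrow> (\<forall>(k, l)\<in>{(k, l). k \<le> l}.
        gain_vec dueling_game (k, l) \<bullet> q \<le> gain_vec dueling_game (i, j) \<bullet> q)"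
      unfolding actions_dueling by fast
    also have "\<dots> \<longleftrightarrow> ?opt q"
    proof
      assume *: "\<forall>(k, l)\<in>{(k, l). k \<le> l}.
        gain_vec dueling_game (k, l) \<bullet> q \<le> gain_vec dueling_game (i, j) \<bullet> q"
      have le: "2 * arm_prob q k \<le> arm_prob q i + arm_prob q j" for k
        using *[rule_format, of "(k, k)"] by (simp add: gain_vec_dueling_inner)
      from le[of i] le[of j] have "arm_prob q i = arm_prob q j" by linarith
      with le show "?opt q" by simp
    next
      assume *: "?opt q"
      have "gain_vec dueling_game (k, l) \<bullet> q \<le> gain_vec dueling_game (i, j) \<bullet> q" for k l
        unfolding gain_vec_dueling_inner using * by (intro divide_right_mono add_mono) auto
      then show "\<forall>(k, l)\<in>{(k, l). k \<le> l}.
        gain_vec dueling_game (k, l) \<bullet> q \<le> gain_vec dueling_game (i, j) \<bullet> q"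
        by blast
    qed
    finally show ?thesis .
  qed
  then show ?thesis by (simp add: cell_def)
qed

text \<open>With coordinate sum 0, \<open>v\<close> is orthogonal to the direction of the prism as
  well, so the whole prism lies in a hyperplane.\<close>

lemma simplex_volume_eq_0:
  fixes C :: "(real ^ 'm::finite) set"
  assumes "v \<noteq> 0" "\<And>q. q \<in> C \<Longrightarrow> v \<bullet> q = 0" "(\<Sum>m\<in>UNIV. v $ m) = 0"
  shows "simplex_volume C = 0"
proof -
  have "v \<bullet> vec c = 0" for c
    using assms(3) by (simp add: inner_vec_def sum_distrib_right[symmetric])
  then have "{q + t *\<^sub>R vec c | q t. q \<in> C \<and> 0 \<le> t \<and> t \<le> 1} \<subseteq> {x. v \<bullet> x = 0}" for c
    using assms(2) by (auto simp: inner_add_right)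
  then have "negligible {q + t *\<^sub>R vec c | q t. q \<in> C \<and> 0 \<le> t \<and> t \<le> (1::real)}" for c
    using negligible_hyperplane[of v 0] assms(1) by (blast intro: negligible_subset)
  then show ?thesis
    by (simp add: simplex_volume_def negligible_iff_null_sets null_setsD1 Let_def)
qed

text \<open>Swapping the coordinates \<open>i\<close> and \<open>j\<close> permutes the
  outcomes.\<close>

lemma sum_of_bool_coord:
  fixes i j :: "'k::finite"
  shows "(\<Sum>m\<in>UNIV. of_bool (m i) :: real) = (\<Sum>m\<in>UNIV. of_bool (m j))"
  by (rule sum.reindex_bij_witness[where i = "\<lambda>m. m \<circ> Transposition.transpose i j" and j = "\<lambda>m. m \<circ> Transposition.transpose i j"])
    (auto simp: comp_assoc)

lemma strongly_pareto_optimal_dueling: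
  fixes i j :: "'k::{finite, linorder}"
  assumes "strongly_pareto_optimal dueling_game (i, j)"
  shows "i = j"
proof (rule ccontr)
  assume "i \<noteq> j"
  have "i \<le> j" using assms by (simp add: strongly_pareto_optimal_def actions_dueling)
  \<comment> \<open>Pairing \<open>v\<close> with \<open>q\<close> gives the difference of the
    marginals of \<open>i\<close> and \<open>j\<close>, which vanishes on the cell.\<close>
  define v :: "real ^ ('k \<Rightarrow> bool)" where "v = (\<chi> m. of_bool (m i) - of_bool (m j))"
  have "v $ (\<lambda>x. x = i) = 1" using \<open>i \<noteq> j\<close> by (simp add: v_def)
  then have "v \<noteq> 0" by force
  moreover have "v \<bullet> q = 0" if "q \<in> cell dueling_game (i, j)" for q
  proof -
    have "arm_prob q i \<le> arm_prob q j" "arm_prob q j \<le> arm_prob q i"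
      using that unfolding cell_dueling[OF \<open>i \<le> j\<close>] by blast+
    then have "arm_prob q i = arm_prob q j" by simp
    then show ?thesis
      by (simp add: v_def inner_vec_def arm_prob_def left_diff_distrib sum_subtractf)
  qed
  moreover have "(\<Sum>m\<in>UNIV. v $ m) = 0"
    using sum_of_bool_coord[of i j] by (simp add: v_def sum_subtractf)
  ultimately have "simplex_volume (cell dueling_game (i, j)) = 0"
    by (rule simplex_volume_eq_0)
  then show False using assms by (simp add: strongly_pareto_optimal_def)
qed

lemma in_image_transposeI:
  assumes "finite R" "R0 \<subseteq> R"
  shows "(\<Sum>r\<in>R0. y r *\<^sub>R S r) \<in> image_transpose R S"
proof -
  have "(\<Sum>r\<in>R0. y r *\<^sub>R S r) = (\<Sum>r\<in>R. (if r \<in> R0 then y r else 0) *\<^sub>R S r)"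
    using assms by (intro sum.mono_neutral_cong_left) auto
  then show ?thesis by (simp add: image_transpose_def)
qed

lemma locally_observable_dueling:
  fixes i j :: "'k::{finite, linorder}"
  shows "locally_observable dueling_game (i, i) (j, j)"
proof -
  \<comment> \<open>Actions are ordered pairs, so the comparison of the two arms is played as
    \<open>(min i j, max i j)\<close>; a sign below accounts for the order.\<close>
  define a b where "a = min i j" and "b = max i j"
  have ab: "a \<le> b" by (auto simp: a_def b_def min_def max_def)
  let ?R = "local_rows dueling_game (i, i) (j, j)"
  let ?S = "local_signal_matrix dueling_game :: ('k \<times> 'k) \<times> duel_result \<Rightarrow> _"
  have sub: "cell dueling_game (i, i) \<inter> cell dueling_game (j, j) \<subseteq> cell dueling_game (a, b)"
    unfolding cell_dueling[OF ab] cell_dueling[OF order_refl] by (auto simp: a_def b_def min_def max_def)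
  have fin: "finite ?R"
    unfolding local_rows_def by (intro finite_SigmaI) (auto simp: symbols_def)
  have diff: "gain_vec dueling_game (a, a) - gain_vec dueling_game (b, b) =
      (?S ((a, b), Win) - ?S ((a, b), Loss))"
    by (auto simp: vec_eq_iff gain_vec_def local_signal_matrix_def signal_matrix_def
        dueling_game_def less_bool_def le_bool_def)
  have "gain_vec dueling_game (i, i) - gain_vec dueling_game (j, j) =
      (if i \<le> j then 1 else - 1) *\<^sub>R (?S ((a, b), Win) - ?S ((a, b), Loss))"
    unfolding diff[symmetric] by (simp add: a_def b_def min_def max_def)
  also have "\<dots> \<in> image_transpose ?R ?S"
  proof (cases "a = b")
    case True
    \<comment> \<open>An arm compared with itself never yields \<open>Win\<close> or
      \<open>Loss\<close>, so both rows vanish.\<close>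
    then have "?S ((a, b), Win) - ?S ((a, b), Loss) = 0"
      by (simp add: local_signal_matrix_def signal_matrix_def dueling_game_def vec_eq_iff)
    then show ?thesis using in_image_transposeI[OF fin, of "{}"] by simp
  next
    case False
    \<comment> \<open>Only symbols that occur index a row, so outcomes producing \<open>Win\<close>
      and \<open>Loss\<close> are exhibited.\<close>
    have "feedback dueling_game (a, b) (\<lambda>x. x = a) = Win"
      "feedback dueling_game (a, b) (\<lambda>x. x = b) = Loss"
      using False by (auto simp: dueling_game_def)
    then have "{Win, Loss} \<subseteq> symbols dueling_game (a, b)"
      unfolding symbols_def by (metis empty_subsetI insert_subset rangeI)
    then have R0: "{((a, b), Win), ((a, b), Loss)} \<subseteq> ?R"
      using sub ab by (auto simp: local_rows_def actions_dueling)
    show ?thesis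
      using in_image_transposeI[OF fin R0, where S = ?S and
          y = "\<lambda>(_, s). (if i \<le> j then 1 else - 1) * (if s = Win then 1 else - 1)"]
      by (simp add: scaleR_right_diff_distrib split: if_splits)
  qed
  finally show ?thesis by (simp add: locally_observable_def)
qed

lemma easy_game_dueling:
  assumes "CARD('k::{finite, linorder}) > 2"
  shows "easy_game (dueling_game :: ('k \<times> 'k, 'k \<Rightarrow> bool, duel_result) pm_game)"
  unfolding easy_game_def
proof (intro conjI allI impI notI)
  assume "trivial_game (dueling_game :: ('k \<times> 'k, 'k \<Rightarrow> bool, duel_result) pm_game)"
  then obtain i j :: 'k where ij: "i \<le> j" "cell dueling_game (i, j) = prob_simplex"
    by (auto simp: trivial_game_def actions_dueling)
  obtain k where k: "k \<noteq> i"
    using assms by (metis (full_types) One_nat_def UNIV_eq_I card.empty card_insert_le_m1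
      lessI not_less_iff_gr_or_eq numeral_2_eq_2 singleton_iff zero_less_Suc card_1_singleton_iff)
  \<comment> \<open>The point mass on the outcome in which only \<open>k\<close> is useful; arm
    \<open>i\<close> is then never useful, so \<open>q\<close> lies outside the cell.\<close>
  define q :: "real ^ ('k \<Rightarrow> bool)" where "q = (\<chi> m. of_bool (m = (\<lambda>x. x = k)))"
  have prob: "arm_prob q l = of_bool (l = k)" for l
  proof -
    have "arm_prob q l = (\<Sum>m\<in>{\<lambda>x. x = k}. of_bool (m l))"
      unfolding arm_prob_def by (rule sum.mono_neutral_cong_right) (auto simp: q_def)
    then show ?thesis by simp
  qed
  have "(\<Sum>m\<in>UNIV. q $ m) = (\<Sum>m\<in>{\<lambda>x. x = k}. 1)"
    by (rule sum.mono_neutral_cong_right) (auto simp: q_def)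
  then have "q \<in> prob_simplex"
    by (simp add: prob_simplex_def q_def)
  with ij have "arm_prob q k \<le> arm_prob q i"
    unfolding cell_dueling[OF ij(1)] by blast
  with k show False by (simp add: prob)
next
  fix a b :: "'k \<times> 'k"
  assume n: "neighbors dueling_game a b"
  obtain i j k l where "a = (i, j)" "b = (k, l)" by (cases a, cases b)
  with n show "locally_observable dueling_game a b"
    using strongly_pareto_optimal_dueling[of i j] strongly_pareto_optimal_dueling[of k l]
      locally_observable_dueling[of i k] by (simp add: neighbors_def)
qed

section \<open>Lower bound\<close>

text \<open>Minorizes the absolute value by even powers, whose drift along a simple random walk is
  explicit. After scaling by \<open>s\<close> it reads \<open>y^2 - y^4 / 4 <= y\<close>.\<close>

lemma abs_ge_quartic:
  fixes x s :: real
  assumes "s > 0"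
  shows "x\<^sup>2 / s - x ^ 4 / (4 * s ^ 3) \<le> \<bar>x\<bar>"
proof -
  define y where "y = \<bar>x\<bar> / s"
  have y: "0 \<le> y" "\<bar>x\<bar> = s * y" using assms by (auto simp: y_def)
  \<comment> \<open>The right-hand side expands to \<open>y^3 - 4 * y + 4\<close>.\<close>
  have "0 \<le> y * (y - 2)\<^sup>2 + 4 * (y - 1)\<^sup>2" using y by simp
  then have "y - y ^ 3 / 4 \<le> 1" by (simp add: power2_eq_square power3_eq_cube algebra_simps)
  then have le: "s * y * (y - y ^ 3 / 4) \<le> s * y"
    using y assms by (intro mult_left_le) auto
  have "x\<^sup>2 = (s * y) ^ 2" "x ^ 4 = (s * y) ^ 4"
    unfolding y(2)[symmetric] by (simp_all add: power_even_abs)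
  then have "x\<^sup>2 / s - x ^ 4 / (4 * s ^ 3) = s * y * (y - y ^ 3 / 4)"
    using assms by (simp add: power2_eq_square power3_eq_cube power4_eq_xxxx field_simps)
  with le y(2) show ?thesis by simp
qed

text \<open>Against each of the two outcomes that make exactly one of the arms i and j useful, chosen
  uniformly, every action gains at most 1/2 on average, while the difference D of the regrets
  against the two arms performs a simple random walk. The quartic in the potential certifies
  \<open>E \<bar>D\<bar> \<ge> c \<cdot> sqrt T\<close>; its coefficient of \<open>D\<^sup>2\<close> varies with \<open>t\<close> so that the potential has a
  deterministic drift. Choosing each outcome so as not to fall below the mean derandomizes the
  argument.\<close>

lemma exists_outcomes_potential:
  fixes i j :: "'k::{finite, linorder}" and a b :: real and T t :: nat
  assumes "i \<noteq> j" and L: "L \<in> learners dueling_game"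
  defines "R \<equiv> \<lambda>t J k. expected_regret dueling_game L t J (k, k)"
  defines "\<Phi> \<equiv> \<lambda>t D. a * D\<^sup>2 - b * (D ^ 4 + 6 * (real T - real t) * D\<^sup>2)"
  shows "\<exists>J. (\<Sum>s<t. a - b * (1 + 6 * (real T - real s - 1)))
    \<le> \<Phi> t (R t J i - R t J j) + (R t J i + R t J j)"
proof (induction t)
  case 0
  show ?case by (simp add: R_def \<Phi>_def)
next
  case (Suc t)
  then obtain J where J: "(\<Sum>s<t. a - b * (1 + 6 * (real T - real s - 1)))
      \<le> \<Phi> t (R t J i - R t J j) + (R t J i + R t J j)" (is "?S \<le> _") by blast
  define D S where "D = R t J i - R t J j" and "S = R t J i + R t J j"
  let ?g = "mean_gain dueling_game L J t"
  let ?J = "\<lambda>k. J(t := (\<lambda>x. x = k))"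
  note Suc_eq = expected_regret_Suc[OF finite_actions_dueling L]
  have step: "R (Suc t) (?J k) l = R t J l + of_bool (l = k) - ?g (\<lambda>x. x = k)" for k l
  proof -
    have "expected_regret dueling_game L t (?J k) (l, l) = expected_regret dueling_game L t J (l, l)"
      "mean_gain dueling_game L (?J k) t m = mean_gain dueling_game L J t m" for m
      by (auto intro!: expected_regret_cong mean_gain_cong)
    then show ?thesis by (simp add: R_def Suc_eq gain_dueling)
  qed
  define V where "V k = \<Phi> (Suc t) (R (Suc t) (?J k) i - R (Suc t) (?J k) j)
    + (R (Suc t) (?J k) i + R (Suc t) (?J k) j)" for k
  \<comment> \<open>The mean gain cancels in the difference of the regrets, which moves by 1 up or
    down, and counts twice in their sum.\<close>
  have V: "V i = \<Phi> (Suc t) (D + 1) + S + 1 - 2 * ?g (\<lambda>x. x = i)"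
    "V j = \<Phi> (Suc t) (D - 1) + S + 1 - 2 * ?g (\<lambda>x. x = j)"
    using \<open>i \<noteq> j\<close> by (simp_all add: V_def step D_def S_def algebra_simps)
  have "?g (\<lambda>x. x = i) + ?g (\<lambda>x. x = j) \<le> 1"
  proof (rule mean_gain_add[OF finite_actions_dueling L])
    fix c :: "'k \<times> 'k"
    show "gain dueling_game c (\<lambda>x. x = i) + gain dueling_game c (\<lambda>x. x = j) \<le> 1"
      using \<open>i \<noteq> j\<close> by (cases c) (auto simp: gain_dueling)
  qed
  \<comment> \<open>The two fourth powers add up to \<open>2 * D^4 + 12 * D^2 + 2\<close>; the term
    in \<open>D^2\<close> is absorbed as \<open>6 * (T - t)\<close> drops by 6.\<close>
  moreover have "\<Phi> (Suc t) (D + 1) + \<Phi> (Suc t) (D - 1) =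
      2 * (\<Phi> t D + (a - b * (1 + 6 * (real T - real t - 1))))"
    by (simp add: \<Phi>_def power2_eq_square power4_eq_xxxx algebra_simps)
  ultimately have "2 * (?S + (a - b * (1 + 6 * (real T - real t - 1)))) \<le> V i + V j"
    using J unfolding V D_def[symmetric] S_def[symmetric] by (simp only: ring_distribs)
  then have "\<exists>k. ?S + (a - b * (1 + 6 * (real T - real t - 1))) \<le> V k"
    by (metis add_mono_thms_linordered_field(5) linorder_not_le mult_2)
  then show ?case unfolding V_def by (auto)
qed

lemma regret_dueling_ge:
  assumes "CARD('k::{finite, linorder}) > 1"
  shows "sqrt (real T) / 8 \<le> regret (dueling_game :: ('k \<times> 'k, 'k \<Rightarrow> bool, duel_result) pm_game) T"
proof (cases "T = 0")
  case True
  have "0 \<le> regret (dueling_game :: ('k \<times> 'k, 'k \<Rightarrow> bool, duel_result) pm_game) 0"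
  proof (rule regret_ge)
    show "\<exists>J. \<exists>a\<in>actions dueling_game. 0 \<le> expected_regret dueling_game L 0 J a"
      for L :: "('k \<times> 'k, duel_result) learner"
      by (auto simp: actions_dueling)
  qed (auto simp: gain_dueling_bounds)
  with True show ?thesis by simp
next
  case False
  define s where "s = sqrt (real T)"
  have s: "s > 0" "s\<^sup>2 = real T" using False by (auto simp: s_def)
  obtain i j :: 'k where ij: "i \<noteq> j"
    using assms by (metis One_nat_def card_le_Suc0_iff_eq finite_class.finite_UNIV linorder_not_le)
  have "s / 8 \<le> regret (dueling_game :: ('k \<times> 'k, 'k \<Rightarrow> bool, duel_result) pm_game) T"
  proof (rule regret_ge)
    fix L :: "('k \<times> 'k, duel_result) learner"
    assume L: "L \<in> learners dueling_game"
    \<comment> \<open>The coefficients of \<open>abs_ge_quartic\<close> at the scale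
      \<open>s = sqrt T\<close> of the walk.\<close>
    define a b where "a = 1 / s" and "b = 1 / (4 * s ^ 3)"
    define R where "R J k = expected_regret dueling_game L T J (k, k)" for J k
    \<comment> \<open>At \<open>t = T\<close> the moving term \<open>6 * (T - t)\<close> is gone and
      the bare quartic remains.\<close>
    obtain J where J: "(\<Sum>t<T. a - b * (1 + 6 * (real T - real t - 1)))
        \<le> a * (R J i - R J j)\<^sup>2 - b * (R J i - R J j) ^ 4 + (R J i + R J j)"
      using exists_outcomes_potential[OF ij L, where t = T and T = T and a = a and b = b] by (auto simp: R_def)
    have "(\<Sum>t<n. a - b * (1 + 6 * (real T - real t - 1))) =
        n * (a - b * (1 + 6 * (real T - 1))) + 3 * b * n * (real n - 1)" for n
      by (induction n) (simp_all add: algebra_simps)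
    from this[of T] have "(\<Sum>t<T. a - b * (1 + 6 * (real T - real t - 1))) =
        a * real T - 3 * b * (real T)\<^sup>2 + 2 * b * real T"
      by (simp add: power2_eq_square algebra_simps)
    \<comment> \<open>Since \<open>T = s^2\<close>, the terms are \<open>a * T = s\<close> and
      \<open>3 * b * T^2 = 3 * s / 4\<close>.\<close>
    also have "\<dots> = s / 4 + 2 * b * real T"
      using s(1) unfolding s(2)[symmetric] a_def b_def
      by (simp add: power2_eq_square power3_eq_cube field_simps)
    also have "\<dots> \<ge> s / 4"
      using s(1) by (simp add: b_def)
    finally have "s / 4 \<le> (\<Sum>t<T. a - b * (1 + 6 * (real T - real t - 1)))" .
    also note J
    also have "a * (R J i - R J j)\<^sup>2 - b * (R J i - R J j) ^ 4 \<le> \<bar>R J i - R J j\<bar>"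
      using abs_ge_quartic[OF s(1), of "R J i - R J j"] by (simp add: a_def b_def)
    finally have "s / 4 \<le> \<bar>R J i - R J j\<bar> + (R J i + R J j)" by simp
    \<comment> \<open>The right-hand side is twice the larger of the two regrets.\<close>
    then have "s / 8 \<le> R J i \<or> s / 8 \<le> R J j" by linarith
    then show "\<exists>J. \<exists>a\<in>actions dueling_game. s / 8 \<le> expected_regret dueling_game L T J a"
      unfolding R_def by (auto simp: actions_dueling)
  qed (auto simp: gain_dueling_bounds)
  then show ?thesis by (simp add: s_def)
qed

section \<open>Exponential weights for duels\<close>

lemma exp_le_quadratic:
  fixes x :: real
  assumes "\<bar>x\<bar> \<le> 1"
  shows "exp x \<le> 1 + x + x\<^sup>2"
proof (cases "0 \<le> x")
  case True
  with assms exp_bound[of x] show ?thesis by simp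
next
  case False
  define y where "y = - x"
  have y: "0 \<le> y" "y \<le> 1" using False assms by (auto simp: y_def)
  \<comment> \<open>Shows that \<open>1 - y + y^2\<close> dominates the reciprocal of the quadratic
    Taylor polynomial, itself a lower bound for \<open>exp y\<close>.\<close>
  have "(1 - y + y\<^sup>2) * (1 + y + y\<^sup>2 / 2) = 1 + y\<^sup>2 * (1 + y + y\<^sup>2) / 2"
    by (simp add: power2_eq_square field_simps)
  then have "1 \<le> (1 - y + y\<^sup>2) * (1 + y + y\<^sup>2 / 2)" using y by simp
  also have "\<dots> \<le> (1 - y + y\<^sup>2) * exp y"
    using y by (intro mult_left_mono exp_lower_Taylor_quadratic) auto
  finally have "exp (- y) \<le> 1 - y + y\<^sup>2"
    by (simp add: exp_minus field_simps)
  then show ?thesis by (simp add: y_def)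
qed

section \<open>The learner and its estimates\<close>

definition exp_weights :: "real \<Rightarrow> ('k::finite \<Rightarrow> real) \<Rightarrow> 'k \<Rightarrow> real" where
  "exp_weights \<eta> C k = exp (\<eta> * C k) / (\<Sum>l\<in>UNIV. exp (\<eta> * C l))"

text \<open>A mixture with the uniform distribution, which receives mass
  \<open>K * \<eta> / 2\<close> for \<open>K\<close> arms. The floor \<open>\<eta> / 2\<close> keeps
  \<open>\<eta>\<close> times every estimate in [-1, 1], where the quadratic bound on
  \<open>exp\<close> applies.\<close>

definition arm_weights :: "real \<Rightarrow> ('k::finite \<Rightarrow> real) \<Rightarrow> 'k \<Rightarrow> real" where
  "arm_weights \<eta> C k = (1 - real CARD('k) * \<eta> / 2) * exp_weights \<eta> C k + \<eta> / 2"

definition arm_pmf :: "real \<Rightarrow> ('k::finite \<Rightarrow> real) \<Rightarrow> 'k pmf" where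
  "arm_pmf \<eta> C = embed_pmf (arm_weights \<eta> C)"

definition duel_value :: "duel_result \<Rightarrow> real" where
  "duel_value r = (case r of Loss \<Rightarrow> - 1 | Tie \<Rightarrow> 0 | Win \<Rightarrow> 1)"

text \<open>Importance weighting of the observed utility difference \<open>v\<close>, once for each
  of the two draws; a draw with \<open>i = j\<close> contributes 0.\<close>

definition duel_estimate :: "('k \<Rightarrow> real) \<Rightarrow> 'k \<Rightarrow> 'k \<Rightarrow> real \<Rightarrow> 'k \<Rightarrow> real" where
  "duel_estimate p i j v k = (of_bool (k = i) / p i - of_bool (k = j) / p j) * v / 2"

definition estimate_step ::
  "real \<Rightarrow> ('k::finite \<Rightarrow> real) \<Rightarrow> ('k \<times> 'k) \<times> duel_result \<Rightarrow> 'k \<Rightarrow> real" where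
  "estimate_step \<eta> C = (\<lambda>((i, j), r) k. C k + duel_estimate (arm_weights \<eta> C) i j (duel_value r) k)"

text \<open>A learner sees only the history, so the estimates, and with them the weights of each
  past round, are recomputed by a fold.\<close>

definition estimates :: "real \<Rightarrow> (('k::finite \<times> 'k) \<times> duel_result) list \<Rightarrow> 'k \<Rightarrow> real" where
  "estimates \<eta> = foldl (estimate_step \<eta>) (\<lambda>_. 0)"

definition duel_learner :: "real \<Rightarrow> ('k::{finite, linorder} \<times> 'k, duel_result) learner" where
  "duel_learner \<eta> h =
     (let p = arm_pmf \<eta> (estimates \<eta> h) in map_pmf (\<lambda>(a, b). (min a b, max a b)) (pair_pmf p p))"

lemma exp_weights_nonneg: "0 \<le> exp_weights \<eta> C k"
  by (simp add: exp_weights_def sum_nonneg)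

lemma sum_exp_pos: "0 < (\<Sum>k\<in>(UNIV :: 'k::finite set). exp (f k :: real))"
  by (rule sum_pos) auto

lemma sum_exp_weights: "(\<Sum>k\<in>UNIV. exp_weights \<eta> C k) = 1"
  using sum_exp_pos[of "\<lambda>l. \<eta> * C l"] by (simp add: exp_weights_def sum_divide_distrib[symmetric])

lemma sum_arm_weights: "(\<Sum>k\<in>UNIV. arm_weights \<eta> C k) = 1"
  by (simp add: arm_weights_def sum.distrib sum_distrib_left[symmetric] sum_exp_weights)

lemma arm_weights_ge:
  fixes C :: "'k::finite \<Rightarrow> real"
  assumes "real CARD('k) * \<eta> \<le> 1"
  shows "\<eta> / 2 \<le> arm_weights \<eta> C k"
  using assms exp_weights_nonneg[of \<eta> C k] by (simp add: arm_weights_def)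

text \<open>The uniform part has mass at most 1/2. This bounds the ratio of the weights in the
  second-order term.\<close>

lemma exp_weights_le_arm_weights:
  fixes C :: "'k::finite \<Rightarrow> real"
  assumes "0 < \<eta>" "real CARD('k) * \<eta> \<le> 1"
  shows "exp_weights \<eta> C k \<le> 2 * arm_weights \<eta> C k"
proof -
  have "(1 / 2) * exp_weights \<eta> C k \<le> (1 - real CARD('k) * \<eta> / 2) * exp_weights \<eta> C k"
    using assms(2) exp_weights_nonneg by (intro mult_right_mono) auto
  with assms(1) show ?thesis by (simp add: arm_weights_def)
qed

lemma pmf_arm_pmf:
  fixes C :: "'k::finite \<Rightarrow> real"
  assumes "0 < \<eta>" "real CARD('k) * \<eta> \<le> 1"
  shows "pmf (arm_pmf \<eta> C) k = arm_weights \<eta> C k"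
proof -
  have nonneg: "0 \<le> arm_weights \<eta> C l" for l
    using arm_weights_ge[OF assms(2), of C l] assms(1) by linarith
  have "(\<integral>\<^sup>+ x. ennreal (arm_weights \<eta> C x) \<partial>count_space UNIV) = 1"
    by (simp add: nn_integral_count_space_finite nonneg sum_arm_weights)
  then show ?thesis
    unfolding arm_pmf_def using nonneg by (intro pmf_embed_pmf)
qed

section \<open>Moments of the estimates under two independent draws\<close>

lemma expectation_pair_pmf_finite:
  fixes f :: "'k::finite \<times> 'k \<Rightarrow> real"
  shows "measure_pmf.expectation (pair_pmf p p) f = (\<Sum>a\<in>UNIV. \<Sum>b\<in>UNIV. pmf p a * pmf p b * f (a, b))"
  by (subst integral_measure_pmf_real[where A = UNIV])
    (auto simp: pmf_pair sum.cartesian_product UNIV_Times_UNIV[symmetric] mult.commute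
      simp del: UNIV_Times_UNIV intro!: sum.cong)

lemma expectation_duel_learner:
  fixes f :: "'k::{finite, linorder} \<times> 'k \<Rightarrow> real"
  assumes "0 < \<eta>" "real CARD('k) * \<eta> \<le> 1"
  defines "p \<equiv> \<lambda>h. arm_weights \<eta> (estimates \<eta> h)"
  shows "measure_pmf.expectation (duel_learner \<eta> h) f =
    (\<Sum>a\<in>UNIV. \<Sum>b\<in>UNIV. p h a * p h b * f (min a b, max a b))"
  by (simp add: duel_learner_def Let_def expectation_pair_pmf_finite pmf_arm_pmf[OF assms(1,2)] p_def)

lemma duel_learner_in_learners: "duel_learner \<eta> \<in> learners dueling_game"
  by (auto simp: learners_def duel_learner_def Let_def actions_dueling min_def max_def)

text \<open>Exchanging the arms flips the sign of both the bracket and the utility difference, so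
  sorting the drawn pair does not change the estimate.\<close>

lemma duel_estimate_min_max:
  "duel_estimate p (min a b) (max a b)
      (duel_value (feedback dueling_game (min a b, max a b) m)) =
    duel_estimate p a b (of_bool (m a) - of_bool (m b))"
  by (auto simp: fun_eq_iff duel_estimate_def duel_value_def dueling_game_def min_def max_def
      less_bool_def le_bool_def)

lemma estimates_snoc:
  "estimates \<eta> (h @ [((min a b, max a b), feedback dueling_game (min a b, max a b) m)]) k =
    estimates \<eta> h k +
    duel_estimate (arm_weights \<eta> (estimates \<eta> h)) a b (of_bool (m a) - of_bool (m b)) k"
  by (simp add: estimates_def estimate_step_def duel_estimate_min_max)

lemma gain_min_max: "gain dueling_game (min a b, max a b) m = (of_bool (m a) + of_bool (m b)) / 2"
  by (auto simp: gain_dueling min_def max_def)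

lemma sum_pair_weights:
  fixes p :: "'k::finite \<Rightarrow> real"
  assumes "sum p UNIV = 1"
  shows "(\<Sum>a\<in>UNIV. \<Sum>b\<in>UNIV. p a * p b * f a) = (\<Sum>a\<in>UNIV. p a * f a)"
    "(\<Sum>a\<in>UNIV. \<Sum>b\<in>UNIV. p a * p b * f b) = (\<Sum>a\<in>UNIV. p a * f a)"
proof -
  have "(\<Sum>a\<in>UNIV. \<Sum>b\<in>UNIV. p a * p b * f a) = (\<Sum>a\<in>UNIV. p a * f a * sum p UNIV)"
    by (simp add: sum_distrib_left mult_ac)
  then show 1: "(\<Sum>a\<in>UNIV. \<Sum>b\<in>UNIV. p a * p b * f a) = (\<Sum>a\<in>UNIV. p a * f a)"
    by (simp add: assms)
  have "(\<Sum>a\<in>UNIV. \<Sum>b\<in>UNIV. p a * p b * f b) = (\<Sum>a\<in>UNIV. \<Sum>b\<in>UNIV. p a * p b * f a)"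
    by (subst sum.swap) (simp add: mult.commute)
  with 1 show "(\<Sum>a\<in>UNIV. \<Sum>b\<in>UNIV. p a * p b * f b) = (\<Sum>a\<in>UNIV. p a * f a)" by simp
qed

lemma sum_of_bool_eq:
  fixes f :: "'k::finite \<Rightarrow> real"
  shows "(\<Sum>a\<in>UNIV. of_bool (k = a) * f a) = f k"
proof -
  have "(\<Sum>a\<in>UNIV. of_bool (k = a) * f a) = (\<Sum>a\<in>{k}. f a)"
    by (rule sum.mono_neutral_cong_right) auto
  then show ?thesis by simp
qed

text \<open>The factor \<open>1 / p k\<close> cancels the probability of drawing \<open>k\<close>,
  while the other draw averages to the mean under \<open>p\<close>. The two terms are mirror images
  and contribute half each.\<close>

lemma mean_duel_estimate:
  fixes p :: "'k::finite \<Rightarrow> real" and u :: "'k \<Rightarrow> real"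
  assumes "sum p UNIV = 1" "p k > 0"
  shows "(\<Sum>a\<in>UNIV. \<Sum>b\<in>UNIV. p a * p b * duel_estimate p a b (u a - u b) k) =
    u k - (\<Sum>a\<in>UNIV. p a * u a)"
proof -
  let ?q = "\<lambda>a. of_bool (k = a) / p a :: real"
  have q: "(\<Sum>a\<in>UNIV. p a * ?q a * f a) = f k" for f
  proof -
    have "(\<Sum>a\<in>UNIV. p a * ?q a * f a) = (\<Sum>a\<in>UNIV. of_bool (k = a) * f a)"
      using assms(2) by (intro sum.cong) auto
    then show ?thesis by (simp only: sum_of_bool_eq)
  qed
  have half: "(\<Sum>a\<in>UNIV. \<Sum>b\<in>UNIV. p a * p b * (?q a * (u a - u b))) =
      u k - (\<Sum>b\<in>UNIV. p b * u b)"
  proof -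
    have "(\<Sum>a\<in>UNIV. \<Sum>b\<in>UNIV. p a * p b * (?q a * (u a - u b))) =
        (\<Sum>a\<in>UNIV. p a * ?q a * (\<Sum>b\<in>UNIV. p b * (u a - u b)))"
      unfolding sum_distrib_left by (intro sum.cong refl) (simp only: mult_ac)
    also have "\<dots> = (\<Sum>b\<in>UNIV. p b * (u k - u b))" by (rule q)
    also have "\<dots> = sum p UNIV * u k - (\<Sum>b\<in>UNIV. p b * u b)"
      by (simp add: right_diff_distrib sum_subtractf sum_distrib_right)
    finally show ?thesis using assms(1) by simp
  qed
  have "(\<Sum>a\<in>UNIV. \<Sum>b\<in>UNIV. p a * p b * duel_estimate p a b (u a - u b) k) =
      ((\<Sum>a\<in>UNIV. \<Sum>b\<in>UNIV. p a * p b * (?q a * (u a - u b))) +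
      (\<Sum>a\<in>UNIV. \<Sum>b\<in>UNIV. p a * p b * (?q b * (u b - u a)))) / 2"
    unfolding sum.distrib[symmetric] sum_divide_distrib
    by (intro sum.cong) (simp_all add: duel_estimate_def algebra_simps add_divide_distrib diff_divide_distrib)
  also have "(\<Sum>a\<in>UNIV. \<Sum>b\<in>UNIV. p a * p b * (?q b * (u b - u a))) =
      (\<Sum>a\<in>UNIV. \<Sum>b\<in>UNIV. p a * p b * (?q a * (u a - u b)))"
    by (subst sum.swap) (simp add: mult.commute mult.left_commute)
  finally show ?thesis unfolding half by simp
qed

text \<open>The squared bracket is at most the sum of the two squares. Each of these has mean
  \<open>1 / p k\<close>, and the halving in the estimate gives the factor 1/4.\<close>

lemma second_moment_duel_estimate:
  fixes p :: "'k::finite \<Rightarrow> real" and u :: "'k \<Rightarrow> real"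
  assumes "sum p UNIV = 1" "\<And>l. p l > 0" "\<And>l. 0 \<le> u l \<and> u l \<le> 1"
  shows "(\<Sum>a\<in>UNIV. \<Sum>b\<in>UNIV. p a * p b * (duel_estimate p a b (u a - u b) k)\<^sup>2) \<le> 1 / (2 * p k)"
proof -
  let ?q = "\<lambda>a. of_bool (k = a) / (p a)\<^sup>2 :: real"
  have "(\<Sum>a\<in>UNIV. p a * ?q a) = (\<Sum>a\<in>UNIV. of_bool (k = a) * (1 / p a))"
    by (intro sum.cong) (auto simp: power2_eq_square)
  then have q: "(\<Sum>a\<in>UNIV. p a * ?q a) = 1 / p k" by (simp only: sum_of_bool_eq)
  have "(duel_estimate p a b (u a - u b) k)\<^sup>2 \<le> (?q a + ?q b) / 4" for a b
  proof -
    have "\<bar>u a - u b\<bar> \<le> 1" using assms(3)[of a] assms(3)[of b] by linarith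
    then have "(u a - u b)\<^sup>2 \<le> 1" by (simp add: abs_square_le_1)
    then have "(of_bool (k = a) / p a - of_bool (k = b) / p b)\<^sup>2 * (u a - u b)\<^sup>2 \<le>
        (of_bool (k = a) / p a - of_bool (k = b) / p b)\<^sup>2"
      by (intro mult_left_le) auto
    also have "\<dots> \<le> ?q a + ?q b"
      by (auto simp: power_divide)
    finally show ?thesis
      by (simp add: duel_estimate_def power_mult_distrib power_divide)
  qed
  then have "(\<Sum>a\<in>UNIV. \<Sum>b\<in>UNIV. p a * p b * (duel_estimate p a b (u a - u b) k)\<^sup>2) \<le>
      (\<Sum>a\<in>UNIV. \<Sum>b\<in>UNIV. p a * p b * ((?q a + ?q b) / 4))"
    using assms(2) by (intro sum_mono mult_left_mono) (auto simp: less_imp_le)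
  also have "\<dots> = ((\<Sum>a\<in>UNIV. \<Sum>b\<in>UNIV. p a * p b * ?q a) + (\<Sum>a\<in>UNIV. \<Sum>b\<in>UNIV. p a * p b * ?q b)) / 4"
    unfolding sum.distrib[symmetric] sum_divide_distrib
    by (intro sum.cong) (simp_all add: algebra_simps add_divide_distrib)
  also have "\<dots> = 1 / (2 * p k)"
    unfolding sum_pair_weights[OF assms(1)] q by simp
  finally show ?thesis .
qed

text \<open>The floor puts both scaled indicators in [0, 2], so their difference is at most 2 in
  absolute value, and the estimate halves it.\<close>

lemma abs_duel_estimate_le:
  assumes "\<And>l. c / 2 \<le> p l" "c > 0" "\<bar>v\<bar> \<le> 1"
  shows "\<bar>c * duel_estimate p a b v k\<bar> \<le> 1"
proof -
  have q: "0 \<le> of_bool (k = l) / p l" "c * (of_bool (k = l) / p l) \<le> 2" for l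
  proof -
    have "p l > 0" using assms(1)[of l] assms(2) by simp
    then show "0 \<le> of_bool (k = l) / p l" "c * (of_bool (k = l) / p l) \<le> 2"
      using assms(1)[of l] by (auto simp: field_simps)
  qed
  let ?d = "of_bool (k = a) / p a - of_bool (k = b) / p b"
  have "0 \<le> c * (of_bool (k = l) / p l)" for l
    using mult_nonneg_nonneg[OF less_imp_le[OF assms(2)] q(1)] .
  with q(2)[of a] q(2)[of b] have "\<bar>c * ?d\<bar> \<le> 2"
    unfolding right_diff_distrib by (smt (verit, best))
  then have "\<bar>c * ?d\<bar> * \<bar>v\<bar> \<le> 2"
    using assms(3) by (meson abs_ge_zero mult_left_le order_trans)
  then show ?thesis
    by (simp add: duel_estimate_def abs_mult)
qed

section \<open>The log-sum-exp potential, a smooth majorant of the largest scaled estimate\<close>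

definition log_potential :: "real \<Rightarrow> ('k::finite \<Rightarrow> real) \<Rightarrow> real" where
  "log_potential \<eta> C = ln (\<Sum>k\<in>UNIV. exp (\<eta> * C k))"

lemma le_log_potential: "\<eta> * C k \<le> log_potential \<eta> C"
proof -
  have "exp (\<eta> * C k) \<le> (\<Sum>l\<in>UNIV. exp (\<eta> * C l))"
    by (rule member_le_sum) auto
  then show ?thesis
    unfolding log_potential_def using sum_exp_pos by (subst ln_ge_iff)
qed

text \<open>The ratio of the two sums is the mean of \<open>exp (\<eta> * e k)\<close> under the
  exponential weights; the quadratic bound on \<open>exp\<close> and \<open>ln x <= x - 1\<close>
  finish.\<close>

lemma log_potential_add_le:
  fixes C :: "'k::finite \<Rightarrow> real"
  assumes "\<And>k. \<bar>\<eta> * e k\<bar> \<le> 1"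
  shows "log_potential \<eta> (\<lambda>k. C k + e k) \<le>
    log_potential \<eta> C + (\<Sum>k\<in>UNIV. exp_weights \<eta> C k * (\<eta> * e k + (\<eta> * e k)\<^sup>2))"
proof -
  let ?W = "\<lambda>C. \<Sum>k\<in>UNIV. exp (\<eta> * C k)"
  have W: "0 < ?W D" for D :: "'k \<Rightarrow> real" by (rule sum_exp_pos)
  have "?W (\<lambda>k. C k + e k) / ?W C = (\<Sum>k\<in>UNIV. exp_weights \<eta> C k * exp (\<eta> * e k))"
    by (simp add: exp_weights_def sum_divide_distrib ring_distribs exp_add)
  also have "\<dots> \<le> (\<Sum>k\<in>UNIV. exp_weights \<eta> C k * (1 + \<eta> * e k + (\<eta> * e k)\<^sup>2))"
    using assms by (intro sum_mono mult_left_mono exp_le_quadratic exp_weights_nonneg)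
  also have "\<dots> = 1 + (\<Sum>k\<in>UNIV. exp_weights \<eta> C k * (\<eta> * e k + (\<eta> * e k)\<^sup>2))"
    using sum_exp_weights[of \<eta> C] by (simp add: ring_distribs sum.distrib)
  finally have "?W (\<lambda>k. C k + e k) / ?W C - 1 \<le>
      (\<Sum>k\<in>UNIV. exp_weights \<eta> C k * (\<eta> * e k + (\<eta> * e k)\<^sup>2))" by simp
  moreover have "ln (?W (\<lambda>k. C k + e k)) - ln (?W C) \<le> ?W (\<lambda>k. C k + e k) / ?W C - 1"
    using ln_le_minus_one[of "?W (\<lambda>k. C k + e k) / ?W C"] W[of C] W[of "\<lambda>k. C k + e k"]
    by (simp add: ln_div)
  ultimately show ?thesis by (simp add: log_potential_def)
qed

text \<open>Of the constant 3/2, one half is the cost of mixing, left when the mean under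
  \<open>w\<close> nearly cancels that under \<open>p\<close>, and 1 comes from the second
  moments.\<close>

lemma mean_log_potential_step:
  fixes C :: "'k::{finite, linorder} \<Rightarrow> real" and u :: "'k \<Rightarrow> real"
  assumes \<eta>: "0 < \<eta>" "real CARD('k) * \<eta> \<le> 1" and u: "\<And>l. 0 \<le> u l \<and> u l \<le> 1"
  defines "p \<equiv> arm_weights \<eta> C"
  shows "(\<Sum>a\<in>UNIV. \<Sum>b\<in>UNIV. p a * p b *
      log_potential \<eta> (\<lambda>k. C k + duel_estimate p a b (u a - u b) k))
    \<le> log_potential \<eta> C + 3 / 2 * real CARD('k) * \<eta>\<^sup>2"
proof -
  define w where "w = exp_weights \<eta> C"
  let ?e = "\<lambda>a b k. duel_estimate p a b (u a - u b) k"
  have p: "\<eta> / 2 \<le> p l" "0 < p l" for l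
    using arm_weights_ge[OF \<eta>(2), of C l] \<eta>(1) by (auto simp: p_def)
  have sum_p: "sum p UNIV = 1" unfolding p_def by (rule sum_arm_weights)
  have w: "0 \<le> w k" "w k \<le> 2 * p k" for k
    using exp_weights_nonneg exp_weights_le_arm_weights[OF \<eta>] by (auto simp: w_def p_def)
  have sum_w: "sum w UNIV = 1" unfolding w_def by (rule sum_exp_weights)
  have "\<bar>\<eta> * ?e a b k\<bar> \<le> 1" for a b k
    using u[of a] u[of b] by (intro abs_duel_estimate_le p \<eta>) auto
  then have "log_potential \<eta> (\<lambda>k. C k + ?e a b k) \<le>
      log_potential \<eta> C + (\<Sum>k\<in>UNIV. w k * (\<eta> * ?e a b k + (\<eta> * ?e a b k)\<^sup>2))" for a b
    unfolding w_def by (rule log_potential_add_le)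
  then have "(\<Sum>a\<in>UNIV. \<Sum>b\<in>UNIV. p a * p b * log_potential \<eta> (\<lambda>k. C k + ?e a b k)) \<le>
      (\<Sum>a\<in>UNIV. \<Sum>b\<in>UNIV. p a * p b *
        (log_potential \<eta> C + (\<Sum>k\<in>UNIV. w k * (\<eta> * ?e a b k + (\<eta> * ?e a b k)\<^sup>2))))"
    using p by (intro sum_mono mult_left_mono) (auto simp: less_imp_le)
  also have "\<dots> = (\<Sum>a\<in>UNIV. \<Sum>b\<in>UNIV. p a * p b * log_potential \<eta> C) +
      (\<Sum>a\<in>UNIV. \<Sum>b\<in>UNIV. \<Sum>k\<in>UNIV. p a * p b * (w k * (\<eta> * ?e a b k + (\<eta> * ?e a b k)\<^sup>2)))"
    unfolding distrib_left sum.distrib sum_distrib_left ..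
  also have "(\<Sum>a\<in>UNIV. \<Sum>b\<in>UNIV. p a * p b * log_potential \<eta> C) = log_potential \<eta> C"
    unfolding sum_pair_weights[OF sum_p] by (simp add: sum_distrib_right[symmetric] sum_p)
  also have "(\<Sum>a\<in>UNIV. \<Sum>b\<in>UNIV. \<Sum>k\<in>UNIV.
        p a * p b * (w k * (\<eta> * ?e a b k + (\<eta> * ?e a b k)\<^sup>2))) =
      (\<Sum>k\<in>UNIV. \<Sum>a\<in>UNIV. \<Sum>b\<in>UNIV.
        p a * p b * (w k * (\<eta> * ?e a b k + (\<eta> * ?e a b k)\<^sup>2)))"
    by (subst (2) sum.swap, subst sum.swap) rule
  also have "\<dots> = (\<Sum>k\<in>UNIV. w k * (\<eta> * (\<Sum>a\<in>UNIV. \<Sum>b\<in>UNIV. p a * p b * ?e a b k) +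
      \<eta>\<^sup>2 * (\<Sum>a\<in>UNIV. \<Sum>b\<in>UNIV. p a * p b * (?e a b k)\<^sup>2)))"
    unfolding sum_distrib_left sum.distrib[symmetric]
    by (intro sum.cong refl) (simp add: power_mult_distrib algebra_simps)
  also have "\<dots> = \<eta> * (\<Sum>k\<in>UNIV. w k * (u k - (\<Sum>a\<in>UNIV. p a * u a))) +
      \<eta>\<^sup>2 * (\<Sum>k\<in>UNIV. w k * (\<Sum>a\<in>UNIV. \<Sum>b\<in>UNIV. p a * p b * (?e a b k)\<^sup>2))"
    unfolding mean_duel_estimate[OF sum_p p(2)]
    by (simp only: distrib_left sum.distrib sum_distrib_left mult.left_commute)
  also have "(\<Sum>k\<in>UNIV. w k * (u k - (\<Sum>a\<in>UNIV. p a * u a))) \<le> real CARD('k) * \<eta> / 2"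
  proof -
    have "(\<Sum>k\<in>UNIV. w k * (u k - (\<Sum>a\<in>UNIV. p a * u a))) =
        (\<Sum>k\<in>UNIV. w k * u k) - (\<Sum>a\<in>UNIV. p a * u a)"
      by (simp add: right_diff_distrib sum_subtractf sum_distrib_right[symmetric] sum_w)
    also have "\<dots> = (\<Sum>k\<in>UNIV. (w k - p k) * u k)"
      by (simp add: left_diff_distrib sum_subtractf)
    also have "\<dots> \<le> (\<Sum>k\<in>UNIV. real CARD('k) * \<eta> / 2 * w k)"
    proof (rule sum_mono)
      fix k
      \<comment> \<open>Here \<open>w k - p k\<close> equals
        \<open>K * \<eta> / 2 * w k - \<eta> / 2\<close>; the negative term is dropped.\<close>
      have "(w k - p k) * u k \<le> real CARD('k) * \<eta> / 2 * w k * u k"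
        using u[of k] \<eta>(1) by (intro mult_right_mono) (auto simp: p_def arm_weights_def w_def algebra_simps)
      also have "\<dots> \<le> real CARD('k) * \<eta> / 2 * w k"
        using u[of k] \<eta>(1) w(1)[of k] by (intro mult_left_le) auto
      finally show "(w k - p k) * u k \<le> real CARD('k) * \<eta> / 2 * w k" .
    qed
    also have "\<dots> = real CARD('k) * \<eta> / 2"
      unfolding sum_distrib_left[symmetric] sum_w by simp
    finally show ?thesis .
  qed
  also have "(\<Sum>k\<in>UNIV. w k * (\<Sum>a\<in>UNIV. \<Sum>b\<in>UNIV. p a * p b * (?e a b k)\<^sup>2)) \<le>
      (\<Sum>k\<in>(UNIV :: 'k set). 1)"
  proof (rule sum_mono)
    fix k
    \<comment> \<open>The second moment \<open>1 / (2 * p k)\<close> is cancelled by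
      \<open>w k <= 2 * p k\<close>.\<close>
    have "w k * (\<Sum>a\<in>UNIV. \<Sum>b\<in>UNIV. p a * p b * (?e a b k)\<^sup>2) \<le> 2 * p k * (1 / (2 * p k))"
      using w p(2) u sum_p
      by (intro mult_mono second_moment_duel_estimate sum_nonneg mult_nonneg_nonneg)
        (auto simp: less_imp_le)
    then show "w k * (\<Sum>a\<in>UNIV. \<Sum>b\<in>UNIV. p a * p b * (?e a b k)\<^sup>2) \<le> 1"
      using p(2)[of k] by simp
  qed
  finally show ?thesis
    using \<eta>(1) by (simp add: power2_eq_square algebra_simps)
qed

text \<open>Zero initial estimates give the potential \<open>ln K\<close>, to which every round adds
  at most the drift just bounded.\<close>

lemma expectation_log_potential_le:
  fixes J :: "nat \<Rightarrow> 'k::{finite, linorder} \<Rightarrow> bool"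
  assumes \<eta>: "0 < \<eta>" "real CARD('k) * \<eta> \<le> 1"
  shows "measure_pmf.expectation (history dueling_game (duel_learner \<eta>) J t)
      (\<lambda>h. log_potential \<eta> (estimates \<eta> h))
    \<le> ln (real CARD('k)) + real t * (3 / 2 * real CARD('k) * \<eta>\<^sup>2)"
proof (induction t)
  case 0
  show ?case by (simp add: estimates_def log_potential_def)
next
  case (Suc t)
  let ?E = "\<lambda>t. measure_pmf.expectation (history dueling_game (duel_learner \<eta>) J t)"
  note H = finite_actions_dueling duel_learner_in_learners
  let ?B = "3 / 2 * real CARD('k) * \<eta>\<^sup>2"
  have "?E (Suc t) (\<lambda>h. log_potential \<eta> (estimates \<eta> h)) \<le>
      ?E t (\<lambda>h. log_potential \<eta> (estimates \<eta> h) + ?B)"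
    unfolding expectation_history_Suc[OF H] expectation_duel_learner[OF \<eta>] estimates_snoc[abs_def]
    by (intro integral_mono integrable_history[OF H] mean_log_potential_step[OF \<eta>]) auto
  also have "\<dots> = ?E t (\<lambda>h. log_potential \<eta> (estimates \<eta> h)) + ?B"
    by (simp add: integrable_history[OF H])
  finally show ?case using Suc unfolding of_nat_Suc distrib_right by linarith
qed

text \<open>The estimates are biased by exactly the learner's own mean gain, so they track the regret
  itself rather than the hidden gains.\<close>

lemma expectation_estimates:
  fixes J :: "nat \<Rightarrow> 'k::{finite, linorder} \<Rightarrow> bool"
  assumes \<eta>: "0 < \<eta>" "real CARD('k) * \<eta> \<le> 1"
  shows "measure_pmf.expectation (history dueling_game (duel_learner \<eta>) J t) (\<lambda>h. estimates \<eta> h k) =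
    expected_regret dueling_game (duel_learner \<eta>) t J (k, k)"
proof (induction t)
  case 0
  show ?case by (simp add: estimates_def)
next
  case (Suc t)
  let ?E = "\<lambda>t. measure_pmf.expectation (history dueling_game (duel_learner \<eta>) J t)"
  note H = finite_actions_dueling duel_learner_in_learners
  let ?p = "\<lambda>h. arm_weights \<eta> (estimates \<eta> h)"
  let ?u = "\<lambda>a. of_bool (J t a) :: real"
  have p: "sum (?p h) UNIV = 1" "0 < ?p h k" for h :: "(('k \<times> 'k) \<times> duel_result) list" and k
    using sum_arm_weights arm_weights_ge[OF \<eta>(2), of "estimates \<eta> h" k] \<eta>(1) by auto
  have E_linear: "?E t (\<lambda>h. f h + (c - g h)) = ?E t f + c - ?E t g" for f g and c :: real
    by (simp add: integrable_history[OF H])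
  have "?E (Suc t) (\<lambda>h. estimates \<eta> h k) =
      ?E t (\<lambda>h. \<Sum>a\<in>UNIV. \<Sum>b\<in>UNIV. ?p h a * ?p h b * estimates \<eta> h k +
        ?p h a * ?p h b * duel_estimate (?p h) a b (?u a - ?u b) k)"
    unfolding expectation_history_Suc[OF H] expectation_duel_learner[OF \<eta>] estimates_snoc distrib_left ..
  also have "\<dots> = ?E t (\<lambda>h. estimates \<eta> h k + (?u k - (\<Sum>a\<in>UNIV. ?p h a * ?u a)))"
    unfolding sum.distrib mean_duel_estimate[OF p] sum_pair_weights[OF p(1)]
    by (simp add: sum_distrib_right[symmetric] p(1))
  also have "\<dots> = ?E t (\<lambda>h. estimates \<eta> h k) + ?u k - ?E t (\<lambda>h. \<Sum>a\<in>UNIV. ?p h a * ?u a)"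
    by (rule E_linear)
  \<comment> \<open>The gain is the average utility of two draws from the same distribution, so its
    mean is exactly the centering term of the estimates.\<close>
  also have "?E t (\<lambda>h. \<Sum>a\<in>UNIV. ?p h a * ?u a) = mean_gain dueling_game (duel_learner \<eta>) J t (J t)"
  proof -
    have "(\<Sum>a\<in>UNIV. \<Sum>b\<in>UNIV. ?p h a * ?p h b * ((?u a + ?u b) / 2)) = (\<Sum>a\<in>UNIV. ?p h a * ?u a)" for h
    proof -
      have "(\<Sum>a\<in>UNIV. \<Sum>b\<in>UNIV. ?p h a * ?p h b * ((?u a + ?u b) / 2)) =
          ((\<Sum>a\<in>UNIV. \<Sum>b\<in>UNIV. ?p h a * ?p h b * ?u a) +
           (\<Sum>a\<in>UNIV. \<Sum>b\<in>UNIV. ?p h a * ?p h b * ?u b)) / 2"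
        unfolding sum.distrib[symmetric] sum_divide_distrib
        by (intro sum.cong refl) (simp only: distrib_left times_divide_eq_right)
      then show ?thesis unfolding sum_pair_weights[OF p(1)] by simp
    qed
    then show ?thesis
      unfolding mean_gain_def expectation_duel_learner[OF \<eta>] gain_min_max by simp
  qed
  finally show ?case
    unfolding Suc expected_regret_Suc[OF H] by (simp add: gain_dueling)
qed

text \<open>The gain of \<open>(i, j)\<close> is the average of two diagonal gains, so regret bounds
  against diagonal actions carry over to all actions.\<close>

lemma expected_regret_dueling_pair:
  fixes i j :: "'k::{finite, linorder}"
  assumes "L \<in> learners dueling_game"
  shows "expected_regret dueling_game L t J (i, j) =
    (expected_regret dueling_game L t J (i, i) + expected_regret dueling_game L t J (j, j)) / 2"
  by (induction t) (simp_all add: expected_regret_Suc[OF finite_actions_dueling assms] gain_dueling field_simps)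

text \<open>The potential majorizes \<open>\<eta>\<close> times the estimate of each arm, whose mean
  is the regret against it; the bound on the potential is then divided by
  \<open>\<eta>\<close>.\<close>

lemma regret_dueling_le:
  assumes \<eta>: "0 < \<eta>" "real CARD('k::{finite, linorder}) * \<eta> \<le> 1"
  shows "regret (dueling_game :: ('k \<times> 'k, 'k \<Rightarrow> bool, duel_result) pm_game) T
    \<le> ln (real CARD('k)) / \<eta> + 3 / 2 * real CARD('k) * \<eta> * real T"
proof (rule regret_le)
  fix J :: "nat \<Rightarrow> 'k \<Rightarrow> bool" and a :: "'k \<times> 'k"
  let ?B = "ln (real CARD('k)) / \<eta> + 3 / 2 * real CARD('k) * \<eta> * real T"
  let ?R = "expected_regret dueling_game (duel_learner \<eta>) T J"
  let ?E = "measure_pmf.expectation (history dueling_game (duel_learner \<eta>) J T)"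
  note H = finite_actions_dueling duel_learner_in_learners
  have "?R (k, k) \<le> ?B" for k
  proof -
    have "\<eta> * ?R (k, k) = ?E (\<lambda>h. \<eta> * estimates \<eta> h k)"
      by (simp add: expectation_estimates[OF \<eta>])
    also have "\<dots> \<le> ?E (\<lambda>h. log_potential \<eta> (estimates \<eta> h))"
      by (intro integral_mono integrable_history[OF H] le_log_potential)
    also have "\<dots> \<le> ln (real CARD('k)) + real T * (3 / 2 * real CARD('k) * \<eta>\<^sup>2)"
      by (rule expectation_log_potential_le[OF \<eta>])
    also have "\<dots> = \<eta> * ?B"
      using \<eta>(1) by (simp add: field_simps power2_eq_square)
    finally show ?thesis using \<eta>(1) by simp
  qed
  note le = this
  have mean_le: "(x + y) / 2 \<le> B" if "x \<le> B" "y \<le> B" for x y B :: real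
    using that by (simp add: field_simps)
  obtain i j where a: "a = (i, j)" by (cases a)
  show "?R a \<le> ?B"
    unfolding a expected_regret_dueling_pair[OF duel_learner_in_learners, of _ _ _ i j]
    by (rule mean_le[OF le le])
qed (auto simp: gain_dueling_bounds duel_learner_in_learners)


theorem corollary3:
  assumes "CARD('k::{finite, linorder}) > 2"
  shows "easy_game (dueling_game :: ('k \<times> 'k, 'k \<Rightarrow> bool, duel_result) pm_game) \<and>
    regret (dueling_game :: ('k \<times> 'k, 'k \<Rightarrow> bool, duel_result) pm_game)
      \<in> soft_Theta (\<lambda>T. sqrt (real T))"
proof -
  let ?R = "regret (dueling_game :: ('k \<times> 'k, 'k \<Rightarrow> bool, duel_result) pm_game)"
  let ?c = "ln (real CARD('k)) + 3 / 2 * real CARD('k)"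
  have lower: "sqrt (real T) / 8 \<le> ?R T" for T
    using assms by (intro regret_dueling_ge) simp
  moreover have nonneg: "0 \<le> ?R T" for T
    using lower[of T] by (rule order_trans[rotated]) simp
  ultimately have "?R \<in> \<Omega>(\<lambda>T. sqrt (real T))"
    by (intro landau_omega.bigI[of "1 / 8"]) (auto intro!: always_eventually)
  moreover have "?R \<in> O(\<lambda>T. sqrt (real T))"
  proof (rule bigoI)
    show "\<forall>\<^sub>F T in sequentially. norm (?R T) \<le> ?c * norm (sqrt (real T))"
      using eventually_ge_at_top[of "CARD('k)\<^sup>2"] eventually_gt_at_top[of 0]
    proof eventually_elim
      case (elim T)
      \<comment> \<open>Balances \<open>ln K / \<eta>\<close> against \<open>K * \<eta> * T\<close>;
        \<open>T >= K^2\<close> ensures \<open>K * \<eta> <= 1\<close>.\<close>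
      define \<eta> where "\<eta> = 1 / sqrt (real T)"
      have "real CARD('k) \<le> sqrt (real T)"
        using elim(1) by (simp add: real_le_rsqrt flip: of_nat_power)
      then have \<eta>: "0 < \<eta>" "real CARD('k) * \<eta> \<le> 1"
        using elim(2) by (simp_all add: \<eta>_def)
      have "?R T \<le> ln (real CARD('k)) / \<eta> + 3 / 2 * real CARD('k) * (\<eta> * real T)"
        using regret_dueling_le[OF \<eta>, of T] by (simp only: mult.assoc)
      also have "\<eta> * real T = sqrt (real T)"
        by (simp add: \<eta>_def real_div_sqrt)
      finally have "?R T \<le> ?c * sqrt (real T)"
        by (simp add: \<eta>_def ring_distribs)
      with nonneg show ?case by simp
    qed
  qed
  ultimately have "?R \<in> soft_Theta (\<lambda>T. sqrt (real T))"
    \<comment> \<open>The exponent 0: both bounds hold without a logarithmic factor.\<close>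
    unfolding soft_Theta_def by (auto intro!: exI[of _ 0])
  with easy_game_dueling[OF assms] show ?thesis by blast
qed

end
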